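(* Let $K\subset\mathbb{R}^2$ be a (non-degenerate) triangle with set of edges $\mathcal{E}_K$ and set of vertices $\mathcal{V}_K$, and let $\mathbb{X}_\triangle(K)=\operatorname{sym}(\boldsymbol{RT}^0(K)\otimes\boldsymbol{RT}^1(K))$. The following degrees of freedom (linear functionals of $\boldsymbol M\in\mathbb{X}_\triangle(K)$) are unisolvent for $\mathbb{X}_\triangle(K)$, i.e., every $\boldsymbol M\in\mathbb{X}_\triangle(K)$ is uniquely determined by their values and all values can be prescribed arbitrarily: (i) the moments $\frac{1}{\|\ell_{E,k}\|_E^2}\langle \mathrm{tr}_{K,E,\boldsymbol n}\boldsymbol M,\ell_{E,k}\rangle_E$ for $k=0,1$ and all $E\in\mathcal{E}_K$; (ii) the moments $\langle \mathrm{tr}_{K,E,\boldsymbol t}\boldsymbol M,\ell_{E,k}\rangle_E$ for $k=0,1$ and all $E\in\mathcal{E}_K$; (iii) the values $[\boldsymbol t\cdot\boldsymbol M\boldsymbol n]_{\partial K}(z)$ for all $z\in\mathcal{V}_K$.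
   Context: $P^p(K)$: polynomials of degree $\le p$; $P^p_{\mathrm{hom}}(K)$: homogeneous polynomials of degree $p$; $\boldsymbol x$ denotes the function $(x,y)\mapsto(x,y)^\top$; $\boldsymbol{RT}^p(K)=P^p(K)^2\oplus\boldsymbol xP^p_{\mathrm{hom}}(K)$. $\operatorname{sym}(\boldsymbol M)=\frac12(\boldsymbol M+\boldsymbol M^\top)$ (applied to spaces: image), $\boldsymbol X\otimes\boldsymbol Y=\operatorname{span}\{\boldsymbol\phi\boldsymbol\psi^\top:\boldsymbol\phi\in\boldsymbol X,\boldsymbol\psi\in\boldsymbol Y\}$. $\boldsymbol n$, $\boldsymbol t$: unit exterior normal and unit tangent (positive orientation) along $\partial K$; edges are oriented accordingly. $\mathrm{tr}_{K,E,\boldsymbol n}\boldsymbol M=\boldsymbol n\cdot\boldsymbol M\boldsymbol n|_E$ and $\mathrm{tr}_{K,E,\boldsymbol t}\boldsymbol M=(\boldsymbol n\cdot\mathbf{div}\boldsymbol M+\partial_{\boldsymbol t}(\boldsymbol t\cdot\boldsymbol M\boldsymbol n))|_E$, with $\mathbf{div}$ the row-wise divergence. For a vertex $z$ that is the end point of edge $E$ and the starting point of edge $E'$, $[\boldsymbol t\cdot\boldsymbol M\boldsymbol n]_{\partial K}(z)=(\boldsymbol t\cdot\boldsymbol M\boldsymbol n)|_E(z)-(\boldsymbol t\cdot\boldsymbol M\boldsymbol n)|_{E'}(z)$. $\ell_{E,k}\in P^k(E)$ is the Legendre polynomial of degree $k$ on $E$, normalized to have value $1$ at the end point of $E$. $\langle\cdot,\cdot\rangle_E$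 and $\|\cdot\|_E$ are the $L_2(E)$ inner product and norm. *)

theory Defs
  imports "HOL-Analysis.Analysis" "HOL-Library.Function_Algebras"
    "HOL-Computational_Algebra.Polynomial"
begin

instantiation "fun" :: (type, real_vector) real_vector
begin

definition scaleR_fun :: "real \<Rightarrow> ('a \<Rightarrow> 'b) \<Rightarrow> 'a \<Rightarrow> 'b"
  where "scaleR_fun c f = (\<lambda>x. c *\<^sub>R f x)"

instance
  by standard (simp_all add: fun_eq_iff scaleR_fun_def scaleR_add_right scaleR_add_left)

end

lemma scaleR_fun_apply [simp]: "(c *\<^sub>R f) x = c *\<^sub>R f x"
  for f :: "'a \<Rightarrow> 'b::real_vector"
  by (simp add: scaleR_fun_def)


text \<open>
  Polynomial functions on a triangle are represented by polynomial functions on the whole plane.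
  A triangle has nonempty interior, so such a function is determined by its restriction to the
  triangle and the two readings give isomorphic spaces. This is why the spaces below carry no
  domain argument.
\<close>

definition P :: "nat \<Rightarrow> (real^2 \<Rightarrow> real) set"
  where "P p = span {\<lambda>x. (x $ 1) ^ i * (x $ 2) ^ j | i j. i + j \<le> p}"

definition P_hom :: "nat \<Rightarrow> (real^2 \<Rightarrow> real) set"
  where "P_hom p = span {\<lambda>x. (x $ 1) ^ i * (x $ 2) ^ j | i j. i + j = p}"

definition P_vec :: "nat \<Rightarrow> (real^2 \<Rightarrow> real^2) set"
  where "P_vec p = {v. \<forall>i. (\<lambda>x. v x $ i) \<in> P p}"

text \<open>The sum is automatically direct.\<close>

definition RT :: "nat \<Rightarrow> (real^2 \<Rightarrow> real^2) set"
  where "RT p = {\<lambda>x. v x + q x *\<^sub>R x | v q. v \<in> P_vec p \<and> q \<in> P_hom p}"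

definition outer :: "real^2 \<Rightarrow> real^2 \<Rightarrow> real^2^2"
  where "outer u v = (columnvector u :: real^1^2) ** rowvector v"

definition tensor_space ::
    "(real^2 \<Rightarrow> real^2) set \<Rightarrow> (real^2 \<Rightarrow> real^2) set \<Rightarrow> (real^2 \<Rightarrow> real^2^2) set"
  where "tensor_space X Y = span {\<lambda>x. outer (\<phi> x) (\<psi> x) | \<phi> \<psi>. \<phi> \<in> X \<and> \<psi> \<in> Y}"

definition sym_mat :: "real^2^2 \<Rightarrow> real^2^2"
  where "sym_mat M = (1 / 2) *\<^sub>R (M + transpose M)"

definition X_triangle :: "(real^2 \<Rightarrow> real^2^2) set"
  where "X_triangle = (\<lambda>M x. sym_mat (M x)) ` tensor_space (RT 0) (RT 1)"


text \<open>
  In the following, \<open>K\<close> is a triangle and \<open>E\<close> one of its edges. The tangent is the exterior unit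
  normal rotated by a quarter turn counterclockwise, that is, \<open>K\<close> lies to the left of its boundary.
\<close>

definition edge_normal :: "(real^2) set \<Rightarrow> (real^2) set \<Rightarrow> real^2"
  where "edge_normal K E = (THE n. norm n = 1 \<and> (\<forall>p\<in>E. \<forall>x\<in>K. n \<bullet> (x - p) \<le> 0))"

definition edge_tangent :: "(real^2) set \<Rightarrow> (real^2) set \<Rightarrow> real^2"
  where "edge_tangent K E = vector [- (edge_normal K E $ 2), edge_normal K E $ 1]"

definition edge_start :: "(real^2) set \<Rightarrow> (real^2) set \<Rightarrow> real^2"
  where "edge_start K E =
    (THE p. p \<in> E \<and> (\<forall>x\<in>E. edge_tangent K E \<bullet> p \<le> edge_tangent K E \<bullet> x))"

definition edge_end :: "(real^2) set \<Rightarrow> (real^2) set \<Rightarrow> real^2"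
  where "edge_end K E =
    (THE p. p \<in> E \<and> (\<forall>x\<in>E. edge_tangent K E \<bullet> x \<le> edge_tangent K E \<bullet> p))"

definition edge_length :: "(real^2) set \<Rightarrow> (real^2) set \<Rightarrow> real"
  where "edge_length K E = dist (edge_start K E) (edge_end K E)"

text \<open>Arc length parametrization of the edge, starting at its starting point.\<close>

definition edge_point :: "(real^2) set \<Rightarrow> (real^2) set \<Rightarrow> real \<Rightarrow> real^2"
  where "edge_point K E s = edge_start K E + s *\<^sub>R edge_tangent K E"

definition edge_inner ::
    "(real^2) set \<Rightarrow> (real^2) set \<Rightarrow> (real^2 \<Rightarrow> real) \<Rightarrow> (real^2 \<Rightarrow> real) \<Rightarrow> real"
  where "edge_inner K E f g =
    integral {0..edge_length K E} (\<lambda>s. f (edge_point K E s) * g (edge_point K E s))"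

definition edge_norm :: "(real^2) set \<Rightarrow> (real^2) set \<Rightarrow> (real^2 \<Rightarrow> real) \<Rightarrow> real"
  where "edge_norm K E f = sqrt (edge_inner K E f f)"

text \<open>Rodrigues' formula for the Legendre polynomials on \<open>[-1, 1]\<close>, with value 1 at 1.\<close>

definition legendre :: "nat \<Rightarrow> real poly"
  where "legendre k = smult (1 / (2 ^ k * fact k)) ((pderiv ^^ k) ([:-1, 0, 1:] ^ k))"

lemma legendre_0: "legendre 0 = 1"
  by (simp add: legendre_def)

lemma legendre_1: "legendre 1 = [:0, 1:]"
  by (simp add: legendre_def pderiv_pCons)

text \<open>Legendre polynomial on the edge, which is mapped affinely onto \<open>[-1, 1]\<close> with the end point
  going to 1; only its values on the edge matter.\<close>

definition edge_legendre :: "(real^2) set \<Rightarrow> (real^2) set \<Rightarrow> nat \<Rightarrow> real^2 \<Rightarrow> real"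
  where "edge_legendre K E k x =
    poly (legendre k)
      (2 * (edge_tangent K E \<bullet> (x - edge_start K E)) / edge_length K E - 1)"


definition dir_deriv :: "(real^2 \<Rightarrow> real) \<Rightarrow> real^2 \<Rightarrow> real^2 \<Rightarrow> real"
  where "dir_deriv f v x = deriv (\<lambda>h. f (x + h *\<^sub>R v)) 0"

definition row_div :: "(real^2 \<Rightarrow> real^2^2) \<Rightarrow> real^2 \<Rightarrow> real^2"
  where "row_div M x = (\<chi> i. \<Sum>j\<in>UNIV. dir_deriv (\<lambda>y. M y $ i $ j) (axis j 1) x)"

definition tMn :: "(real^2) set \<Rightarrow> (real^2) set \<Rightarrow> (real^2 \<Rightarrow> real^2^2) \<Rightarrow> real^2 \<Rightarrow> real"
  where "tMn K E M x = edge_tangent K E \<bullet> (M x *v edge_normal K E)"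

definition tr_n :: "(real^2) set \<Rightarrow> (real^2) set \<Rightarrow> (real^2 \<Rightarrow> real^2^2) \<Rightarrow> real^2 \<Rightarrow> real"
  where "tr_n K E M x = edge_normal K E \<bullet> (M x *v edge_normal K E)"

definition tr_t :: "(real^2) set \<Rightarrow> (real^2) set \<Rightarrow> (real^2 \<Rightarrow> real^2^2) \<Rightarrow> real^2 \<Rightarrow> real"
  where "tr_t K E M x =
    edge_normal K E \<bullet> row_div M x + dir_deriv (tMn K E M) (edge_tangent K E) x"

definition edge_ending_at :: "(real^2) set \<Rightarrow> real^2 \<Rightarrow> (real^2) set"
  where "edge_ending_at K z = (THE E. E edge_of K \<and> edge_end K E = z)"

definition edge_starting_at :: "(real^2) set \<Rightarrow> real^2 \<Rightarrow> (real^2) set"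
  where "edge_starting_at K z = (THE E. E edge_of K \<and> edge_start K E = z)"

definition jump :: "(real^2) set \<Rightarrow> (real^2 \<Rightarrow> real^2^2) \<Rightarrow> real^2 \<Rightarrow> real"
  where "jump K M z = tMn K (edge_ending_at K z) M z - tMn K (edge_starting_at K z) M z"

end

theory Submission
  imports Defs
begin

text \<open>
  Fix a base point \<open>b\<close> and write \<open>y = x - b\<close>. The Raviart--Thomas spaces are invariant under
  translation, so the elements of the space are exactly the tensors
  \<open>M = S\<^sub>0 + y\<^sub>1 S\<^sub>1 + y\<^sub>2 S\<^sub>2 + sym (y (A y)\<^sup>T) + (c \<bullet> y) y y\<^sup>T\<close>
  with symmetric matrices \<open>S\<^sub>0\<close>, \<open>S\<^sub>1\<close>, \<open>S\<^sub>2\<close>, a matrix \<open>A\<close> and a vector \<open>c\<close> (\<open>X_triangle_eq\<close>).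
  These are 15 real coefficients, and there are 15 degrees of freedom. They depend linearly on the
  coefficients, so unisolvence follows once vanishing degrees of freedom force vanishing
  coefficients.

  The degrees of freedom are governed by the values of \<open>M\<close> and of its divergence \<open>d\<close> at the three
  vertices. Let \<open>e\<close> be an edge vector and \<open>\<nu>\<close> its clockwise rotation, a multiple of the exterior
  normal. Along the edge \<open>\<nu> \<bullet> y\<close> is constant, which lowers the polynomial degrees: \<open>\<nu> \<bullet> M \<nu>\<close> and
  \<open>\<nu> \<bullet> d\<close> are affine and \<open>e \<bullet> M \<nu>\<close> is quadratic. Moreover the quadratic part of \<open>e \<bullet> M \<nu>\<close> is
  a fixed multiple of the increment of \<open>\<nu> \<bullet> d\<close> along the edge (\<open>tangential_on_line\<close>). Hence the
  first-order moment of the second trace is a nonzero multiple of that increment, and all degrees of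
  freedom are explicit combinations of vertex values (\<open>edge_moments\<close>, \<open>jump_eq\<close>).

  Suppose that they all vanish. At a vertex the normal-normal components for both adjacent edges are
  zero, and the jump then kills the remaining component of the symmetric matrix \<open>M\<close>
  (\<open>symmetric_eq_0_if_traces_0\<close>). With \<open>M = 0\<close> at the vertices, the moments of the second trace give
  \<open>\<nu> \<bullet> d = 0\<close> at both end points of every edge, so \<open>d\<close> vanishes at the vertices, too. Finally take
  a vertex as base point. Then \<open>d = 0\<close> at the other two vertices says that the edge vectors \<open>u\<close>, \<open>v\<close>
  emanating from it are eigenvectors of \<open>A\<close>, and \<open>M = 0\<close> there determines \<open>S\<^sub>1\<close> and \<open>S\<^sub>2\<close> as
  combinations of \<open>u u\<^sup>T\<close> and \<open>v v\<^sup>T\<close>; comparing with the constant part of the divergence leaves only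
  zero coefficients (\<open>eq_0_if_vertex_values_0\<close>).
\<close>

section \<open>Plane geometry of an oriented triangle\<close>

text \<open>The rotation by a quarter turn clockwise turns counterclockwise edge vectors into exterior normals.
  Also \<open>u \<bullet> cw v\<close> is the determinant with columns \<open>u\<close> and \<open>v\<close>.\<close>

definition cw :: "real^2 \<Rightarrow> real^2"
  where "cw v = vector [v $ 2, - v $ 1]"

lemma cw_nth [simp]: "cw v $ 1 = v $ 2" "cw v $ 2 = - v $ 1"
  by (simp_all add: cw_def)

lemma inner_2: "x \<bullet> y = x $ 1 * y $ 1 + x $ 2 * y $ 2"
  for x y :: "real^2"
  by (simp add: inner_vec_def sum_2)

lemma matrix_vector_mult_2: "(M *v x) $ i = M $ i $ 1 * x $ 1 + M $ i $ 2 * x $ 2"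
  for M :: "real^2^'n"
  by (simp add: matrix_vector_mult_def sum_2)

lemma vec_eq_2: "x = y \<longleftrightarrow> x $ 1 = y $ 1 \<and> x $ 2 = y $ 2"
  for x y :: "'a^2"
  by (simp add: vec_eq_iff forall_2)

lemma norm_cw [simp]: "norm (cw v) = norm v"
  by (simp add: norm_eq_sqrt_inner inner_2 algebra_simps)

lemma inner_cw_self [simp]: "v \<bullet> cw v = 0" "cw v \<bullet> v = 0"
  by (simp_all add: inner_2)

lemma inner_cw_commute: "u \<bullet> cw v = - (v \<bullet> cw u)"
  by (simp add: inner_2)

lemma cw_decomposition: "(e \<bullet> e) *\<^sub>R n = (n \<bullet> cw e) *\<^sub>R cw e + (n \<bullet> e) *\<^sub>R e"
  by (simp add: vec_eq_2 inner_2 algebra_simps)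

text \<open>The vertices are listed counterclockwise, so cyclic rotation transfers every fact about the edge from
  \<open>p\<close> to \<open>q\<close> to the other two edges.\<close>

definition pos_triangle :: "(real^2) set \<Rightarrow> real^2 \<Rightarrow> real^2 \<Rightarrow> real^2 \<Rightarrow> bool"
  where "pos_triangle K p q r \<longleftrightarrow> K = convex hull {p, q, r} \<and> 0 < (q - p) \<bullet> cw (r - p)"

lemma pos_triangle_rotate: "pos_triangle K p q r \<Longrightarrow> pos_triangle K q r p"
proof -
  assume T: "pos_triangle K p q r"
  have "{q, r, p} = {p, q, r}" by blast
  moreover have "(r - q) \<bullet> cw (p - q) = (q - p) \<bullet> cw (r - p)"
    by (simp add: inner_2 algebra_simps)
  ultimately show ?thesis
    using T by (simp add: pos_triangle_def)
qed

text \<open>A vector orthogonal to \<open>cw e\<close> is a multiple of \<open>e\<close> by \<open>cw_decomposition\<close>.\<close>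

lemma inner_cw_eq_0_imp_collinear:
  assumes "(q - p) \<bullet> cw (r - p) = 0"
  shows "collinear {p, q, r}"
proof -
  have "((q - p) \<bullet> (q - p)) *\<^sub>R (r - p) = ((r - p) \<bullet> (q - p)) *\<^sub>R (q - p)"
    using cw_decomposition[of "q - p" "r - p"] assms inner_cw_commute[of "r - p" "q - p"] by simp
  then have "q - p = 0 \<or> r - p = (((r - p) \<bullet> (q - p)) / ((q - p) \<bullet> (q - p))) *\<^sub>R (q - p)"
    by (metis eq_vector_fraction_iff inner_eq_zero_iff)
  then have "collinear {0, q - p, r - p}"
    unfolding collinear_lemma by blast
  then have "collinear {q, p, r}"
    by (subst collinear_3) simp_all
  then show ?thesis
    by (simp add: insert_commute)
qed

lemma simplex_imp_pos_triangle:
  assumes "2 simplex K"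
  obtains p q r where "pos_triangle K p q r"
proof -
  from assms obtain C where C: "\<not> affine_dependent C" "int (card C) = 2 + 1" "K = convex hull C"
    unfolding simplex_def by auto
  then have "card C = 3" by simp
  then obtain p q r where pqr: "C = {p, q, r}" "p \<noteq> q" "q \<noteq> r" "p \<noteq> r"
    by (auto simp: card_3_iff)
  then have "\<not> collinear {p, q, r}"
    using C(1) by (simp add: collinear_3_eq_affine_dependent)
  then have "(q - p) \<bullet> cw (r - p) \<noteq> 0"
    using inner_cw_eq_0_imp_collinear by blast
  moreover have "(r - p) \<bullet> cw (q - p) = - ((q - p) \<bullet> cw (r - p))"
    by (simp add: inner_2 algebra_simps)
  moreover have "{p, q, r} = {p, r, q}" by blast
  ultimately have "pos_triangle K p q r \<or> pos_triangle K p r q"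
    unfolding pos_triangle_def using C(3) pqr(1) by (simp add: insert_commute) linarith
  then show thesis using that by blast
qed

lemma pos_triangle_independent:
  assumes "pos_triangle K p q r"
  shows "\<not> affine_dependent {p, q, r}" "p \<noteq> q" "q \<noteq> r" "r \<noteq> p"
proof -
  have D: "(q - p) \<bullet> cw (r - p) > 0"
    using assms by (simp add: pos_triangle_def)
  then show ne: "p \<noteq> q" "q \<noteq> r" "r \<noteq> p"
    by (auto simp: inner_2 algebra_simps)
  have "\<not> collinear {p, q, r}"
  proof
    assume "collinear {p, q, r}"
    then have "collinear {q, p, r}" by (simp add: insert_commute)
    then have "collinear {0, q - p, r - p}"
      by (subst (asm) collinear_3) simp_all
    then obtain c where "r - p = c *\<^sub>R (q - p)"
      using ne by (auto simp: collinear_lemma)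
    then show False using D by (simp add: inner_2)
  qed
  then show "\<not> affine_dependent {p, q, r}"
    using ne by (simp add: collinear_3_eq_affine_dependent)
qed

text \<open>The edges of a triangle are its facets, and a facet of a simplex omits exactly one vertex.\<close>

lemma edge_of_pos_triangle:
  assumes "pos_triangle K p q r"
  shows "E edge_of K \<longleftrightarrow> E \<in> {convex hull {p, q}, convex hull {q, r}, convex hull {r, p}}"
proof -
  note indep = pos_triangle_independent[OF assms]
  have K: "K = convex hull {p, q, r}"
    using assms by (simp add: pos_triangle_def)
  have card: "card {p, q, r} = 3"
    using indep by simp
  then have "aff_dim K = 2"
    using aff_dim_affine_independent[OF indep(1)] by (simp add: K aff_dim_convex_hull)
  then have "E edge_of K \<longleftrightarrow> E facet_of K"
    unfolding edge_of_def facet_of_def by (metis aff_dim_empty add_diff_cancel_right' diff_add_cancel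
        one_add_one one_neq_neg_one)
  also have "\<dots> \<longleftrightarrow> (\<exists>u. u \<in> {p, q, r} \<and> E = convex hull ({p, q, r} - {u}))"
    using facet_of_convex_hull_affine_independent_alt[OF indep(1)] card by (simp add: K)
  also have "\<dots> \<longleftrightarrow> E \<in> {convex hull {p, q}, convex hull {q, r}, convex hull {r, p}}"
  proof -
    have "{p, q, r} - {r} = {p, q}" "{p, q, r} - {p} = {q, r}" "{p, q, r} - {q} = {r, p}"
      using indep by auto
    then show ?thesis by (metis insert_iff empty_iff)
  qed
  finally show ?thesis .
qed

lemma extreme_point_of_pos_triangle:
  assumes "pos_triangle K p q r"
  shows "z extreme_point_of K \<longleftrightarrow> z \<in> {p, q, r}"
  using extreme_point_of_convex_hull_affine_independent[OF pos_triangle_independent(1)[OF assms]] assms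
  unfolding pos_triangle_def by blast

text \<open>Testing the defining inequality of the normal at the two end points against each other shows that it
  is orthogonal to the edge; the third vertex fixes its sign.\<close>

lemma edge_normal_eq:
  assumes "pos_triangle K p q r"
  shows "edge_normal K (convex hull {p, q}) = cw (q - p) /\<^sub>R norm (q - p)"
  unfolding edge_normal_def
proof (rule the_equality)
  let ?e = "q - p" let ?L = "norm (q - p)"
  have D: "?e \<bullet> cw (r - p) > 0" and K: "K = convex hull {p, q, r}"
    using assms by (simp_all add: pos_triangle_def)
  have L: "?L > 0" using pos_triangle_independent[OF assms] by simp
  have neg: "cw ?e \<bullet> (r - p) < 0"
    using D by (simp add: inner_2 algebra_simps)
  have const: "cw ?e \<bullet> y = cw ?e \<bullet> p" if y: "y \<in> convex hull {p, q}" for y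
  proof -
    obtain u v where "u \<ge> 0" "v \<ge> 0" "u + v = 1" "y = u *\<^sub>R p + v *\<^sub>R q"
      using y by (auto simp: convex_hull_2)
    then have "y = p + v *\<^sub>R ?e"
      by (simp add: algebra_simps flip: scaleR_add_left)
    then show ?thesis
      by (simp add: inner_add_right)
  qed
  have le: "cw ?e \<bullet> x \<le> cw ?e \<bullet> p" if x: "x \<in> K" for x
  proof -
    have "K \<subseteq> {x. cw ?e \<bullet> x \<le> cw ?e \<bullet> p}"
      unfolding K using neg const[of q]
      by (intro hull_minimal) (auto simp: convex_halfspace_le inner_diff_right hull_inc)
    then show ?thesis using x by blast
  qed
  show "norm (cw ?e /\<^sub>R ?L) = 1 \<and>
      (\<forall>y\<in>convex hull {p, q}. \<forall>x\<in>K. (cw ?e /\<^sub>R ?L) \<bullet> (x - y) \<le> 0)"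
    using L le const by (auto simp: inner_diff_right intro!: mult_nonneg_nonpos)
  fix n
  assume n: "norm n = 1 \<and> (\<forall>y\<in>convex hull {p, q}. \<forall>x\<in>K. n \<bullet> (x - y) \<le> 0)"
  have mem: "p \<in> convex hull {p, q}" "q \<in> convex hull {p, q}" "p \<in> K" "q \<in> K" "r \<in> K"
    by (simp_all add: K hull_inc)
  have "n \<bullet> (q - p) \<le> 0" "n \<bullet> (p - q) \<le> 0" and nr: "n \<bullet> (r - p) \<le> 0"
    using n mem by blast+
  then have ne: "n \<bullet> ?e = 0"
    by (simp add: inner_diff_right)
  define c where "c = (n \<bullet> cw ?e) / ?L\<^sup>2"
  have "?L\<^sup>2 *\<^sub>R n = (n \<bullet> cw ?e) *\<^sub>R cw ?e + (n \<bullet> ?e) *\<^sub>R ?e"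
    using cw_decomposition[of ?e n] by (simp add: power2_norm_eq_inner)
  also have "\<dots> = ?L\<^sup>2 *\<^sub>R (c *\<^sub>R cw ?e)"
    using L ne by (simp add: c_def)
  finally have nc: "n = c *\<^sub>R cw ?e"
    by (rule scaleR_left_imp_eq[rotated]) (use L in simp)
  then have "\<bar>c\<bar> * ?L = 1"
    using n by simp
  moreover have "c > 0"
  proof -
    have "c \<ge> 0"
      using nr neg nc by (simp add: mult_le_0_iff) 
    moreover have "c \<noteq> 0"
      using n nc by auto
    ultimately show ?thesis by simp
  qed
  ultimately have "c = inverse ?L"
    using L by (simp add: field_simps)
  then show "n = cw ?e /\<^sub>R ?L"
    using nc by simp
qed

lemma edge_tangent_eq:
  assumes "pos_triangle K p q r"
  shows "edge_tangent K (convex hull {p, q}) = (q - p) /\<^sub>R norm (q - p)"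
  by (simp add: edge_tangent_def edge_normal_eq[OF assms] vec_eq_2 algebra_simps)

lemma edge_start_end_eq:
  assumes "pos_triangle K p q r"
  shows "edge_start K (convex hull {p, q}) = p" "edge_end K (convex hull {p, q}) = q"
proof -
  let ?t = "edge_tangent K (convex hull {p, q})"
  have L: "norm (q - p) > 0" using pos_triangle_independent[OF assms] by simp
  then have tpos: "?t \<bullet> (q - p) > 0"
    by (simp add: edge_tangent_eq[OF assms] dot_square_norm)
  have pt: "\<exists>v\<ge>0. v \<le> 1 \<and> y = p + v *\<^sub>R (q - p)" if y: "y \<in> convex hull {p, q}" for y
  proof -
    obtain u v where "u \<ge> 0" "v \<ge> 0" "u + v = 1" "y = u *\<^sub>R p + v *\<^sub>R q"
      using y by (auto simp: convex_hull_2)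
    moreover from this have "y = p + v *\<^sub>R (q - p)"
      by (simp add: algebra_simps flip: scaleR_add_left)
    ultimately show ?thesis by (intro exI[of _ v]) auto
  qed
  have val: "?t \<bullet> (p + v *\<^sub>R (q - p)) = ?t \<bullet> p + v * (?t \<bullet> (q - p))" for v
    by (simp add: inner_add_right)
  have tq: "?t \<bullet> q = ?t \<bullet> p + ?t \<bullet> (q - p)"
    by (simp add: inner_diff_right)
  have mem: "p \<in> convex hull {p, q}" "q \<in> convex hull {p, q}"
    by (simp_all add: hull_inc)
  show "edge_start K (convex hull {p, q}) = p"
    unfolding edge_start_def
  proof (rule the_equality)
    show "p \<in> convex hull {p, q} \<and> (\<forall>x\<in>convex hull {p, q}. ?t \<bullet> p \<le> ?t \<bullet> x)"
      using tpos pt mem by (fastforce simp: val)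
  next
    fix y assume y: "y \<in> convex hull {p, q} \<and> (\<forall>x\<in>convex hull {p, q}. ?t \<bullet> y \<le> ?t \<bullet> x)"
    then obtain v where v: "v \<ge> 0" "v \<le> 1" "y = p + v *\<^sub>R (q - p)" using pt by blast
    have "?t \<bullet> y \<le> ?t \<bullet> p" using y mem by blast
    then have "v * (?t \<bullet> (q - p)) \<le> 0" unfolding v(3) val by simp
    then have "v = 0" using tpos v(1) by (simp add: mult_le_0_iff)
    then show "y = p" using v by simp
  qed
  show "edge_end K (convex hull {p, q}) = q"
    unfolding edge_end_def
  proof (rule the_equality)
    have "?t \<bullet> x \<le> ?t \<bullet> q" if x: "x \<in> convex hull {p, q}" for x
    proof -
      obtain v where v: "v \<ge> 0" "v \<le> 1" "x = p + v *\<^sub>R (q - p)" using pt x by blast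
      have "v * (?t \<bullet> (q - p)) \<le> 1 * (?t \<bullet> (q - p))"
        using v tpos by (intro mult_right_mono) auto
      then show ?thesis unfolding v(3) val tq by simp
    qed
    then show "q \<in> convex hull {p, q} \<and> (\<forall>x\<in>convex hull {p, q}. ?t \<bullet> x \<le> ?t \<bullet> q)"
      using mem by blast
  next
    fix y assume y: "y \<in> convex hull {p, q} \<and> (\<forall>x\<in>convex hull {p, q}. ?t \<bullet> x \<le> ?t \<bullet> y)"
    then obtain v where v: "v \<ge> 0" "v \<le> 1" "y = p + v *\<^sub>R (q - p)" using pt by blast
    have "?t \<bullet> q \<le> ?t \<bullet> y" using y mem by blast
    then have "1 * (?t \<bullet> (q - p)) \<le> v * (?t \<bullet> (q - p))" unfolding v(3) val tq by simp
    then have "1 \<le> v" using tpos mult_le_cancel_right_pos by blast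
    then have "v = 1" using v by simp
    then show "y = q" using v by simp
  qed
qed

lemma edge_length_eq:
  assumes "pos_triangle K p q r"
  shows "edge_length K (convex hull {p, q}) = norm (q - p)"
  by (simp add: edge_length_def edge_start_end_eq[OF assms] dist_norm norm_minus_commute)

lemma edges_at_vertex_eq:
  assumes "pos_triangle K p q r"
  shows "edge_ending_at K q = convex hull {p, q}" "edge_starting_at K q = convex hull {q, r}"
proof -
  note T = assms pos_triangle_rotate[OF assms] pos_triangle_rotate[OF pos_triangle_rotate[OF assms]]
  note ne = pos_triangle_independent(2-4)[OF assms]
  note e = T[THEN edge_start_end_eq(1)] T[THEN edge_start_end_eq(2)]
  show "edge_ending_at K q = convex hull {p, q}"
    unfolding edge_ending_at_def edge_of_pos_triangle[OF assms]
  proof (rule the_equality)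
    show "convex hull {p, q} \<in> {convex hull {p, q}, convex hull {q, r}, convex hull {r, p}} \<and>
        edge_end K (convex hull {p, q}) = q"
      by (simp only: e) simp
    fix E assume "E \<in> {convex hull {p, q}, convex hull {q, r}, convex hull {r, p}} \<and> edge_end K E = q"
    then show "E = convex hull {p, q}"
      using e(4-6) ne by (metis insertE emptyE)
  qed
  show "edge_starting_at K q = convex hull {q, r}"
    unfolding edge_starting_at_def edge_of_pos_triangle[OF assms]
  proof (rule the_equality)
    show "convex hull {q, r} \<in> {convex hull {p, q}, convex hull {q, r}, convex hull {r, p}} \<and>
        edge_start K (convex hull {q, r}) = q"
      by (simp only: e) simp
    fix E assume "E \<in> {convex hull {p, q}, convex hull {q, r}, convex hull {r, p}} \<and> edge_start K E = q"
    then show "E = convex hull {q, r}"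
      using e(1-3) ne by (metis insertE emptyE)
  qed
qed

section \<open>Coefficients for the tensor space\<close>

lemma span_three: "f \<in> span {a, b, c} \<longleftrightarrow> (\<exists>r s t. f = r *\<^sub>R a + (s *\<^sub>R b + t *\<^sub>R c))"
proof -
  have "f \<in> span {a, b, c} \<longleftrightarrow> (\<exists>r s t. f - r *\<^sub>R a - s *\<^sub>R b = t *\<^sub>R c)"
    unfolding span_breakdown_eq[of f] span_breakdown_eq[of "f - _"] span_singleton by blast
  also have "\<dots> \<longleftrightarrow> (\<exists>r s t. f = r *\<^sub>R a + (s *\<^sub>R b + t *\<^sub>R c))"
    by (simp only: diff_eq_eq add.commute add.left_commute add.assoc)
  finally show ?thesis .
qed

lemma span_two: "f \<in> span {a, b} \<longleftrightarrow> (\<exists>s t. f = s *\<^sub>R a + t *\<^sub>R b)"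
proof -
  have "f \<in> span {a, b} \<longleftrightarrow> (\<exists>s t. f - s *\<^sub>R a = t *\<^sub>R b)"
    unfolding span_breakdown_eq[of f] span_singleton by blast
  also have "\<dots> \<longleftrightarrow> (\<exists>s t. f = s *\<^sub>R a + t *\<^sub>R b)"
    by (simp only: diff_eq_eq add.commute)
  finally show ?thesis .
qed

lemma P_0: "P 0 = {f. \<exists>k. f = (\<lambda>_. k)}"
proof -
  have "{\<lambda>x::real^2. (x $ 1) ^ i * (x $ 2) ^ j | i j. i + j \<le> 0} = {\<lambda>_. 1}"
    by auto
  then show ?thesis
    unfolding P_def by (auto simp: span_singleton fun_eq_iff)
qed

lemma P_hom_0: "P_hom 0 = {f. \<exists>k. f = (\<lambda>_. k)}"
proof -
  have "{\<lambda>x::real^2. (x $ 1) ^ i * (x $ 2) ^ j | i j. i + j = 0} = {\<lambda>_. 1}"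
    by auto
  then show ?thesis
    unfolding P_hom_def by (auto simp: span_singleton fun_eq_iff)
qed

lemma affine_form_iff:
  "(\<exists>s t. f = (\<lambda>x::real^2. r + (s * x $ 1 + t * x $ 2))) \<longleftrightarrow> (\<exists>c. f = (\<lambda>x. r + c \<bullet> x))"
  for r :: real
proof safe
  fix s t
  have "(\<lambda>x::real^2. r + (s * x $ 1 + t * x $ 2)) = (\<lambda>x. r + vector [s, t] \<bullet> x)"
    by (simp add: inner_2)
  then show "\<exists>c. (\<lambda>x::real^2. r + (s * x $ 1 + t * x $ 2)) = (\<lambda>x. r + c \<bullet> x)" by blast
next
  fix c :: "real^2"
  show "\<exists>s t. (\<lambda>x. r + c \<bullet> x) = (\<lambda>x. r + (s * x $ 1 + t * x $ 2))"
    unfolding inner_2 by blast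
qed

lemma P_1: "P 1 = {f. \<exists>k c. f = (\<lambda>x. k + c \<bullet> x)}"
proof -
  let ?m = "\<lambda>(i, j) x::real^2. (x $ 1) ^ i * (x $ 2) ^ j"
  have "{\<lambda>x::real^2. (x $ 1) ^ i * (x $ 2) ^ j | i j. i + j \<le> 1} = ?m ` {(i, j). i + j \<le> 1}"
    by auto
  also have "{(i, j). i + j \<le> (1::nat)} = {(0, 0), (1, 0), (0, 1)}"
    by auto
  finally have "P 1 = span {\<lambda>_. 1, \<lambda>x. x $ 1, \<lambda>x. x $ 2}"
    by (simp add: P_def)
  then have "f \<in> P 1 \<longleftrightarrow> (\<exists>r s t. f = (\<lambda>x. r + (s * x $ 1 + t * x $ 2)))" for f
    by (simp add: span_three fun_eq_iff)
  then show ?thesis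
    unfolding affine_form_iff by blast
qed

lemma P_hom_1: "P_hom 1 = {f. \<exists>c. f = (\<lambda>x. c \<bullet> x)}"
proof -
  let ?m = "\<lambda>(i, j) x::real^2. (x $ 1) ^ i * (x $ 2) ^ j"
  have "{\<lambda>x::real^2. (x $ 1) ^ i * (x $ 2) ^ j | i j. i + j = 1} = ?m ` {(i, j). i + j = 1}"
    by auto
  also have "{(i, j). i + j = (1::nat)} = {(1, 0), (0, 1)}"
    by auto
  finally have "P_hom 1 = span {\<lambda>x. x $ 1, \<lambda>x. x $ 2}"
    by (simp add: P_hom_def)
  then have "f \<in> P_hom 1 \<longleftrightarrow> (\<exists>s t. f = (\<lambda>x. 0 + (s * x $ 1 + t * x $ 2)))" for f
    by (simp add: span_two fun_eq_iff)
  then show ?thesis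
    unfolding affine_form_iff by simp blast
qed

lemma outer_nth [simp]: "outer u v $ i $ j = u $ i * v $ j"
  by (simp add: outer_def matrix_matrix_mult_def columnvector_def rowvector_def)

text \<open>The Raviart--Thomas functions are written relative to a base point \<open>b\<close>, so that a vertex of the
  triangle can serve as the origin.\<close>

definition rt0 :: "real^2 \<Rightarrow> real^2 \<Rightarrow> real \<Rightarrow> real^2 \<Rightarrow> real^2"
  where "rt0 b a s x = a + s *\<^sub>R (x - b)"

definition rt1 :: "real^2 \<Rightarrow> real^2 \<Rightarrow> real^2^2 \<Rightarrow> real^2 \<Rightarrow> real^2 \<Rightarrow> real^2"
  where "rt1 b a A c x = a + A *v (x - b) + (c \<bullet> (x - b)) *\<^sub>R (x - b)"

lemma RT_0_iff: "\<phi> \<in> RT 0 \<longleftrightarrow> (\<exists>a s. \<phi> = rt0 b a s)"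
proof -
  have v: "v \<in> P_vec 0 \<longleftrightarrow> (\<exists>a. v = (\<lambda>_. a))" for v
  proof
    assume "v \<in> P_vec 0"
    then obtain k where "\<And>i x. v x $ i = k i"
      unfolding P_vec_def P_0 by (simp add: fun_eq_iff) metis
    then have "v = (\<lambda>_. \<chi> i. k i)" by (simp add: fun_eq_iff vec_eq_iff)
    then show "\<exists>a. v = (\<lambda>_. a)" by blast
  qed (auto simp: P_vec_def P_0)
  have "\<phi> \<in> RT 0 \<longleftrightarrow> (\<exists>a s. \<phi> = (\<lambda>x. a + s *\<^sub>R x))"
    unfolding RT_def P_hom_0 mem_Collect_eq v
    by (intro iffI; elim exE conjE) (simp, blast, rule exI, rule exI, erule conjI, blast)
  also have "\<dots> \<longleftrightarrow> (\<exists>a s. \<phi> = rt0 b a s)"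
  proof safe
    fix a s
    have "(\<lambda>x. a + s *\<^sub>R x) = rt0 b (a + s *\<^sub>R b) s"
      by (simp add: rt0_def fun_eq_iff algebra_simps)
    then show "\<exists>a' s'. (\<lambda>x. a + s *\<^sub>R x) = rt0 b a' s'" by blast
  next
    fix a s
    have "rt0 b a s = (\<lambda>x. (a - s *\<^sub>R b) + s *\<^sub>R x)"
      by (simp add: rt0_def fun_eq_iff algebra_simps)
    then show "\<exists>a' s'. rt0 b a s = (\<lambda>x. a' + s' *\<^sub>R x)" by blast
  qed
  finally show ?thesis .
qed

text \<open>Moving the base point changes the quadratic part only by affine terms, which \<open>a\<close> and \<open>A\<close> absorb.\<close>

lemma rt1_recentre: "\<exists>a' A'. rt1 b a A c = rt1 b' a' A' c"
proof -
  let ?A = "A + (c \<bullet> (b' - b)) *\<^sub>R mat 1 + outer (b' - b) c"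
  have "rt1 b a A c x = rt1 b' (a + A *v (b' - b) + (c \<bullet> (b' - b)) *\<^sub>R (b' - b)) ?A c x" for x
  proof -
    define y d where "y = x - b'" and "d = b' - b"
    have "x - b = y + d" by (simp add: y_def d_def)
    then show ?thesis
      unfolding rt1_def y_def[symmetric] d_def[symmetric]
      by (simp add: vec_eq_2 matrix_vector_mult_2 inner_2 mat_def algebra_simps)
  qed
  then show ?thesis by blast
qed

lemma RT_1_iff: "\<psi> \<in> RT 1 \<longleftrightarrow> (\<exists>a A c. \<psi> = rt1 b a A c)"
proof -
  have v: "v \<in> P_vec 1 \<longleftrightarrow> (\<exists>a A. v = (\<lambda>x. a + A *v x))" for v
  proof
    assume "v \<in> P_vec 1"
    then have "\<forall>i. \<exists>k c. \<forall>x. v x $ i = k + c \<bullet> x"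
      unfolding P_vec_def P_1 by (simp add: fun_eq_iff)
    then obtain k c where "\<And>i x. v x $ i = k i + c i \<bullet> x" by metis
    then have "v = (\<lambda>x. (\<chi> i. k i) + (\<chi> i. c i) *v x)"
      by (simp add: fun_eq_iff vec_eq_iff matrix_vector_mult_2 inner_2)
    then show "\<exists>a A. v = (\<lambda>x. a + A *v x)" by blast
  next
    assume "\<exists>a A. v = (\<lambda>x. a + A *v x)"
    then obtain a A where "v = (\<lambda>x. a + A *v x)" by blast
    then have "(\<lambda>x. v x $ i) = (\<lambda>x. a $ i + A $ i \<bullet> x)" for i
      by (simp add: fun_eq_iff matrix_vector_mult_2 inner_2)
    then show "v \<in> P_vec 1"
      unfolding P_vec_def P_1 by blast
  qed
  have "\<psi> \<in> RT 1 \<longleftrightarrow> (\<exists>a A c. \<psi> = (\<lambda>x. a + A *v x + (c \<bullet> x) *\<^sub>R x))"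
    unfolding RT_def P_hom_1 mem_Collect_eq v
    by (intro iffI; elim exE conjE) (simp, blast, (rule exI)+, erule conjI, blast)
  also have "\<dots> \<longleftrightarrow> (\<exists>a A c. \<psi> = rt1 0 a A c)"
    by (simp add: rt1_def[abs_def])
  also have "\<dots> \<longleftrightarrow> (\<exists>a A c. \<psi> = rt1 b a A c)"
    using rt1_recentre by metis
  finally show ?thesis .
qed

lemma sym_mat_nth [simp]: "sym_mat M $ i $ j = (M $ i $ j + M $ j $ i) / 2"
  by (simp add: sym_mat_def transpose_def)

definition sym_of :: "real^3 \<Rightarrow> real^2^2"
  where "sym_of s = vector [vector [s $ 1, s $ 2], vector [s $ 2, s $ 3]]"

lemma sym_of_nth [simp]:
  "sym_of s $ 1 $ 1 = s $ 1" "sym_of s $ 1 $ 2 = s $ 2"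
  "sym_of s $ 2 $ 1 = s $ 2" "sym_of s $ 2 $ 2 = s $ 3"
  by (simp_all add: sym_of_def)

text \<open>Symmetric matrices are encoded by vectors of length 3, so that the type of coefficients has dimension
  15.\<close>

type_synonym coeffs = "(real^3) \<times> (real^3) \<times> (real^3) \<times> (real^2^2) \<times> (real^2)"

definition tensor_field :: "real^2 \<Rightarrow> coeffs \<Rightarrow> real^2 \<Rightarrow> real^2^2"
  where "tensor_field b \<theta> x = (case \<theta> of (S0, S1, S2, A, c) \<Rightarrow> let y = x - b in
    sym_of S0 + y $ 1 *\<^sub>R sym_of S1 + y $ 2 *\<^sub>R sym_of S2 + sym_mat (outer y (A *v y + (c \<bullet> y) *\<^sub>R y)))"

lemma linear_tensor_field: "linear (\<lambda>\<theta>. tensor_field b \<theta> x)"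
  by (rule linearI)
    (simp_all add: split_paired_all tensor_field_def Let_def vec_eq_2 matrix_vector_mult_2 inner_2
      field_simps)

lemma linear_tensor_field_fun: "linear (tensor_field b)"
  using linear_tensor_field[of b] by (simp add: linear_iff fun_eq_iff)

text \<open>For one inclusion, multiply out \<open>sym (\<phi> \<psi>\<^sup>T)\<close> for a constant plus a multiple of \<open>y\<close> and a function
  \<open>v + V y + (c \<bullet> y) y\<close>: the constant factor of \<open>\<phi>\<close> times the quadratic part of \<open>\<psi>\<close> is again of the
  form \<open>sym (y (A y)\<^sup>T)\<close>. For the other one, the affine part is realised row by row by the constant
  functions of the lowest-order space, and the rest is a single product with the first factor \<open>y\<close>.\<close>

lemma X_triangle_eq: "X_triangle = range (tensor_field b)"
proof
  show "X_triangle \<subseteq> range (tensor_field b)"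
  proof -
    let ?T = "{M. (\<lambda>x. sym_mat (M x)) \<in> range (tensor_field b)}"
    have lin: "linear (\<lambda>M (x::real^2). sym_mat (M x))"
      by (rule linearI) (simp_all add: fun_eq_iff vec_eq_2 field_simps)
    have "subspace ((\<lambda>M x. sym_mat (M x)) -` range (tensor_field b))"
      by (intro linear_subspace_vimage[OF lin] linear_subspace_image[OF linear_tensor_field_fun] subspace_UNIV)
    then have sub: "subspace ?T"
      by (simp add: vimage_def)
    have "(\<lambda>x. outer (\<phi> x) (\<psi> x)) \<in> ?T" if \<phi>\<psi>: "\<phi> \<in> RT 0" "\<psi> \<in> RT 1" for \<phi> \<psi>
    proof -
      obtain a s where \<phi>: "\<phi> = rt0 b a s" using \<phi>\<psi>(1) RT_0_iff by blast
      obtain v V c where \<psi>: "\<psi> = rt1 b v V c" using \<phi>\<psi>(2) RT_1_iff by blast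
      define S where "S u w = (vector [u $ 1 * w $ 1, (u $ 1 * w $ 2 + u $ 2 * w $ 1) / 2, u $ 2 * w $ 2] :: real^3)"
        for u w :: "real^2"
      \<comment> \<open>\<open>a (c \<bullet> y) y\<^sup>T\<close> and \<open>s y (V y)\<^sup>T\<close> both contribute to the matrix coefficient.\<close>
      define \<theta> :: coeffs where "\<theta> = (S a v, S a (column 1 V) + s *\<^sub>R S (axis 1 1) v,
        S a (column 2 V) + s *\<^sub>R S (axis 2 1) v, outer a c + s *\<^sub>R V, s *\<^sub>R c)"
      have "sym_mat (outer (\<phi> x) (\<psi> x)) = tensor_field b \<theta> x" for x
      proof -
        define y where "y = x - b"
        show ?thesis
          unfolding \<phi> \<psi> rt0_def rt1_def tensor_field_def \<theta>_def Let_def prod.case S_def y_def[symmetric]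
          by (simp add: vec_eq_2 matrix_vector_mult_2 inner_2 column_def axis_def field_simps)
      qed
      then show ?thesis by (auto simp: fun_eq_iff)
    qed
    then have "tensor_space (RT 0) (RT 1) \<subseteq> ?T"
      unfolding tensor_space_def by (intro span_minimal sub) blast
    then show ?thesis unfolding X_triangle_def by blast
  qed
  show "range (tensor_field b) \<subseteq> X_triangle"
  proof safe
    fix S0 S1 S2 :: "real^3" and A :: "real^2^2" and c :: "real^2"
    \<comment> \<open>\<open>?\<psi> i\<close> is the \<open>i\<close>-th row of the affine part.\<close>
    let ?\<psi> = "\<lambda>i. rt1 b (sym_of S0 $ i) (vector [vector [sym_of S1 $ i $ 1, sym_of S2 $ i $ 1],
      vector [sym_of S1 $ i $ 2, sym_of S2 $ i $ 2]]) 0"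
    let ?M = "(\<lambda>x. outer (rt0 b (axis 1 1) 0 x) (?\<psi> 1 x)) +
      (\<lambda>x. outer (rt0 b (axis 2 1) 0 x) (?\<psi> 2 x)) + (\<lambda>x. outer (rt0 b 0 1 x) (rt1 b 0 A c x))"
    have gen: "(\<lambda>x. outer (rt0 b a s x) (rt1 b v V d x)) \<in> tensor_space (RT 0) (RT 1)" for a s v V d
      unfolding tensor_space_def using RT_0_iff RT_1_iff by (intro span_base) blast
    have mem: "?M \<in> tensor_space (RT 0) (RT 1)"
      using gen unfolding tensor_space_def by (intro span_add) blast+
    have "tensor_field b (S0, S1, S2, A, c) x = sym_mat (?M x)" for x
    proof -
      define y where "y = x - b"
      show ?thesis
        unfolding rt0_def rt1_def tensor_field_def Let_def prod.case plus_fun_apply y_def[symmetric]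
        by (simp add: vec_eq_2 matrix_vector_mult_2 inner_2 axis_def field_simps)
    qed
    then show "tensor_field b (S0, S1, S2, A, c) \<in> X_triangle"
      unfolding X_triangle_def using mem by (intro image_eqI[of _ _ ?M]) auto
  qed
qed

section \<open>Degrees of freedom in terms of vertex values\<close>

text \<open>The row-wise divergence of \<open>tensor_field\<close>: the terms \<open>sym (y (A y)\<^sup>T)\<close> and \<open>(c \<bullet> y) y y\<^sup>T\<close> are
  homogeneous, which gives \<open>2 A y + (tr A / 2) y\<close> and \<open>4 (c \<bullet> y) y\<close>.\<close>

definition field_div :: "real^2 \<Rightarrow> coeffs \<Rightarrow> real^2 \<Rightarrow> real^2"
  where "field_div b \<theta> x = (case \<theta> of (S0, S1, S2, A, c) \<Rightarrow> let y = x - b in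
    vector [S1 $ 1 + S2 $ 2, S1 $ 2 + S2 $ 3] + 2 *\<^sub>R (A *v y) + (trace A / 2 + 4 * (c \<bullet> y)) *\<^sub>R y)"

lemma linear_field_div: "linear (\<lambda>\<theta>. field_div b \<theta> x)"
  by (rule linearI)
    (simp_all add: split_paired_all field_div_def Let_def vec_eq_2 matrix_vector_mult_2 inner_2
      trace_def sum_2 field_simps)

lemma tensor_field_has_derivative:
  fixes b x v :: "real^2"
  defines "y \<equiv> x - b"
  shows "((\<lambda>h. tensor_field b (S0, S1, S2, A, c) (x + h *\<^sub>R v) $ i $ j) has_real_derivative
    v $ 1 * sym_of S1 $ i $ j + v $ 2 * sym_of S2 $ i $ j +
    (v $ i * (A *v y + (c \<bullet> y) *\<^sub>R y) $ j + y $ i * (A *v v + (c \<bullet> v) *\<^sub>R y + (c \<bullet> y) *\<^sub>R v) $ j +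
     v $ j * (A *v y + (c \<bullet> y) *\<^sub>R y) $ i + y $ j * (A *v v + (c \<bullet> v) *\<^sub>R y + (c \<bullet> y) *\<^sub>R v) $ i) / 2) (at 0)"
proof -
  have y: "x + h *\<^sub>R v - b = y + h *\<^sub>R v" for h by (simp add: y_def)
  show ?thesis
    unfolding tensor_field_def Let_def prod.case y
    by (simp add: matrix_vector_right_distrib matrix_vector_mult_scaleR inner_add_right)
      (rule derivative_eq_intros refl | simp add: field_simps)+
qed

lemma row_div_tensor_field: "row_div (tensor_field b \<theta>) = field_div b \<theta>"
proof
  fix x
  obtain S0 S1 S2 A c where \<theta>: "\<theta> = (S0, S1, S2, A, c)" by (cases \<theta>)
  define y where "y = x - b"
  show "row_div (tensor_field b \<theta>) x = field_div b \<theta> x"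
    unfolding row_div_def dir_deriv_def \<theta> DERIV_imp_deriv[OF tensor_field_has_derivative] field_div_def
      Let_def prod.case y_def[symmetric]
    by (simp add: vec_eq_2 sum_2 matrix_vector_mult_2 inner_2 axis_def trace_def field_simps)
qed

lemma inner_tensor_field:
  "u \<bullet> (tensor_field b (S0, S1, S2, A, c) (b + y) *v v) =
    u \<bullet> (sym_of S0 *v v) + y $ 1 * (u \<bullet> (sym_of S1 *v v)) + y $ 2 * (u \<bullet> (sym_of S2 *v v)) +
    ((u \<bullet> y) * (v \<bullet> (A *v y) + (c \<bullet> y) * (v \<bullet> y)) + (u \<bullet> (A *v y) + (c \<bullet> y) * (u \<bullet> y)) * (v \<bullet> y)) / 2"
  unfolding tensor_field_def Let_def prod.case
  by (simp add: matrix_vector_mult_2 inner_2 field_simps)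

text \<open>Here and in the next two lemmas, \<open>cw e \<bullet> y\<close> is constant on lines in direction \<open>e\<close>, so that one
  polynomial degree is lost for each factor \<open>y\<close> paired with \<open>cw e\<close>.\<close>

lemma normal_on_line:
  "cw e \<bullet> (tensor_field b \<theta> (p + \<tau> *\<^sub>R e) *v cw e) =
    (1 - \<tau>) * (cw e \<bullet> (tensor_field b \<theta> p *v cw e)) +
    \<tau> * (cw e \<bullet> (tensor_field b \<theta> (p + e) *v cw e))"
proof -
  obtain S0 S1 S2 A c where \<theta>: "\<theta> = (S0, S1, S2, A, c)" by (cases \<theta>)
  define y where "y = p - b"
  have p: "p = b + y" "b + y + e = b + (y + e)" "b + y + \<tau> *\<^sub>R e = b + (y + \<tau> *\<^sub>R e)"
    by (simp_all add: y_def)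
  show ?thesis
    unfolding \<theta> p inner_tensor_field
    by (simp add: inner_add_right matrix_vector_right_distrib matrix_vector_mult_scaleR field_simps)
qed

lemma field_div_on_line:
  "cw e \<bullet> field_div b \<theta> (p + \<tau> *\<^sub>R e) =
    (1 - \<tau>) * (cw e \<bullet> field_div b \<theta> p) + \<tau> * (cw e \<bullet> field_div b \<theta> (p + e))"
proof -
  obtain S0 S1 S2 A c where \<theta>: "\<theta> = (S0, S1, S2, A, c)" by (cases \<theta>)
  define y where "y = p - b"
  have p: "p - b = y" "p + e - b = y + e" "p + \<tau> *\<^sub>R e - b = y + \<tau> *\<^sub>R e"
    by (simp_all add: y_def)
  show ?thesis
    unfolding \<theta> field_div_def prod.case Let_def p
    by (simp add: inner_add_right matrix_vector_right_distrib matrix_vector_mult_scaleR field_simps)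
qed

text \<open>The key identity. With \<open>\<nu> = cw e\<close>, the quadratic coefficient of the left-hand side is
  \<open>(e \<bullet> e) (\<nu> \<bullet> A e / 2 + (c \<bullet> e) (\<nu> \<bullet> y))\<close>, and the increment of \<open>\<nu> \<bullet> d\<close> is
  \<open>2 (\<nu> \<bullet> A e) + 4 (c \<bullet> e) (\<nu> \<bullet> y)\<close>, where \<open>d\<close> is the divergence. Their ratio does not depend on the
  coefficients. This is why the tangential derivative in the second trace brings in no information
  beyond the vertex values of the tensor and its divergence.\<close>

lemma tangential_on_line:
  "e \<bullet> (tensor_field b \<theta> (p + \<tau> *\<^sub>R e) *v cw e) =
    (1 - \<tau>) * (e \<bullet> (tensor_field b \<theta> p *v cw e)) + \<tau> * (e \<bullet> (tensor_field b \<theta> (p + e) *v cw e))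
    - \<tau> * (1 - \<tau>) * ((e \<bullet> e) * (cw e \<bullet> (field_div b \<theta> (p + e) - field_div b \<theta> p)) / 4)"
proof -
  obtain S0 S1 S2 A c where \<theta>: "\<theta> = (S0, S1, S2, A, c)" by (cases \<theta>)
  define y where "y = p - b"
  have p: "p = b + y" "b + y + e = b + (y + e)" "b + y + \<tau> *\<^sub>R e = b + (y + \<tau> *\<^sub>R e)"
    by (simp_all add: y_def)
  have d: "cw e \<bullet> (field_div b \<theta> (b + (y + e)) - field_div b \<theta> (b + y)) =
      2 * (cw e \<bullet> (A *v e)) + 4 * (c \<bullet> e) * (cw e \<bullet> y)"
    unfolding \<theta> field_div_def prod.case Let_def
    by (simp add: inner_add_right inner_diff_right matrix_vector_right_distrib field_simps)
  show ?thesis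
    unfolding p d unfolding \<theta> inner_tensor_field
    by (simp add: inner_add_right matrix_vector_right_distrib matrix_vector_mult_scaleR field_simps)
qed

text \<open>The normal-normal and tangential-normal entries for an edge vector \<open>e\<close>. Two factors of its length are
  divided out, as required for a unit normal and a unit tangent.\<close>

definition normal_entry :: "(real^2 \<Rightarrow> real^2^2) \<Rightarrow> real^2 \<Rightarrow> real^2 \<Rightarrow> real"
  where "normal_entry M e x = (cw e \<bullet> (M x *v cw e)) / (e \<bullet> e)"

definition tangential_entry :: "(real^2 \<Rightarrow> real^2^2) \<Rightarrow> real^2 \<Rightarrow> real^2 \<Rightarrow> real"
  where "tangential_entry M e x = (e \<bullet> (M x *v cw e)) / (e \<bullet> e)"

lemma tr_n_eq:
  assumes "pos_triangle K p q r"
  shows "tr_n K (convex hull {p, q}) M x = normal_entry M (q - p) x"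
proof -
  have "(q - p) \<bullet> (q - p) = norm (q - p) * norm (q - p)"
    by (simp add: dot_square_norm power2_eq_square)
  then show ?thesis
    unfolding tr_n_def normal_entry_def edge_normal_eq[OF assms]
    by (simp add: matrix_vector_mult_scaleR divide_inverse)
qed

lemma tMn_eq:
  assumes "pos_triangle K p q r"
  shows "tMn K (convex hull {p, q}) M x = tangential_entry M (q - p) x"
proof -
  have "(q - p) \<bullet> (q - p) = norm (q - p) * norm (q - p)"
    by (simp add: dot_square_norm power2_eq_square)
  then show ?thesis
    unfolding tMn_def tangential_entry_def edge_normal_eq[OF assms] edge_tangent_eq[OF assms]
    by (simp add: matrix_vector_mult_scaleR divide_inverse)
qed

lemma tr_t_on_edge:
  fixes b p :: "real^2" and \<theta> :: coeffs
  assumes "pos_triangle K p q r"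
  defines "M \<equiv> tensor_field b \<theta>" and "d \<equiv> field_div b \<theta>" and "e \<equiv> q - p"
  shows "tr_t K (convex hull {p, q}) M (p + \<tau> *\<^sub>R e) =
    (cw e \<bullet> d p + tangential_entry M e q - tangential_entry M e p - cw e \<bullet> (d q - d p) / 4 + \<tau> * (3 / 2 * (cw e \<bullet> (d q - d p)))) / norm e"
proof -
  let ?\<delta> = "cw e \<bullet> (d q - d p)"
  have q: "p + e = q" by (simp add: e_def)
  have e: "e \<bullet> e \<noteq> 0" "norm e \<noteq> 0"
    using pos_triangle_independent(2)[OF assms(1)] by (auto simp: e_def)
  have along: "tangential_entry M e (p + \<sigma> *\<^sub>R e) = (1 - \<sigma>) * tangential_entry M e p + \<sigma> * tangential_entry M e q - \<sigma> * (1 - \<sigma>) * (?\<delta> / 4)" for \<sigma>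
    unfolding tangential_entry_def M_def tangential_on_line[of e b \<theta> p \<sigma>] using e(1) unfolding d_def q
    by (simp add: diff_divide_distrib add_divide_distrib)
  have "dir_deriv (tMn K (convex hull {p, q}) M) (edge_tangent K (convex hull {p, q})) (p + \<tau> *\<^sub>R e) =
      deriv (\<lambda>h. tangential_entry M e (p + (\<tau> + h / norm e) *\<^sub>R e)) 0"
    unfolding dir_deriv_def tMn_eq[OF assms(1)] edge_tangent_eq[OF assms(1)] e_def[symmetric]
    by (simp add: algebra_simps divide_inverse)
  also have "\<dots> = (tangential_entry M e q - tangential_entry M e p - (1 - 2 * \<tau>) * (?\<delta> / 4)) / norm e"
    unfolding along
    by (rule DERIV_imp_deriv) (use e(2) in \<open>auto intro!: derivative_eq_intros simp: field_simps\<close>)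
  finally have D: "dir_deriv (tMn K (convex hull {p, q}) M) (edge_tangent K (convex hull {p, q})) (p + \<tau> *\<^sub>R e) =
      (tangential_entry M e q - tangential_entry M e p - (1 - 2 * \<tau>) * (?\<delta> / 4)) / norm e" .
  have N: "edge_normal K (convex hull {p, q}) \<bullet> row_div M (p + \<tau> *\<^sub>R e) =
      ((1 - \<tau>) * (cw e \<bullet> d p) + \<tau> * (cw e \<bullet> d q)) / norm e"
    unfolding edge_normal_eq[OF assms(1)] M_def row_div_tensor_field e_def[symmetric]
    using field_div_on_line[of e b \<theta> p \<tau>]
    by (simp add: q d_def[symmetric] divide_inverse)
  show ?thesis
    unfolding tr_t_def D N using e(2) by (simp add: inner_diff_right field_simps)
qed

text \<open>On the edge, \<open>\<tau>\<close> runs from 0 to 1 and the Legendre polynomials are \<open>1\<close> and \<open>2 \<tau> - 1\<close>.\<close>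

lemma edge_inner_legendre:
  assumes T: "pos_triangle K p q r"
    and f: "\<And>\<tau>. f (p + \<tau> *\<^sub>R (q - p)) = u + \<tau> * w"
  defines "E \<equiv> convex hull {p, q}" and "L \<equiv> norm (q - p)"
  shows "edge_inner K E f (edge_legendre K E 0) = L * (u + w / 2)"
    and "edge_inner K E f (edge_legendre K E 1) = L * w / 6"
proof -
  have L: "L > 0"
    using pos_triangle_independent(2)[OF T] by (simp add: L_def)
  have pt: "edge_point K E s = p + (s / L) *\<^sub>R (q - p)" for s
    unfolding edge_point_def E_def edge_tangent_eq[OF T] edge_start_end_eq[OF T] L_def
    by (simp add: divide_inverse)
  have leg: "edge_legendre K E k (edge_point K E s) = poly (legendre k) (2 * (s / L) - 1)" for k s
  proof -
    have "edge_tangent K E \<bullet> (edge_point K E s - edge_start K E) = s"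
      unfolding pt unfolding E_def edge_tangent_eq[OF T] edge_start_end_eq[OF T] L_def[symmetric]
      using L by (simp add: dot_square_norm L_def[symmetric] power2_eq_square)
    then show ?thesis
      by (simp add: edge_legendre_def edge_length_eq[OF T, folded E_def L_def])
  qed
  have "((\<lambda>s. u + s / L * w) has_integral (u * L + w * L\<^sup>2 / (2 * L)) - (u * 0 + w * 0\<^sup>2 / (2 * L))) {0..L}"
    using L by (intro fundamental_theorem_of_calculus)
      (auto intro!: derivative_eq_intros simp: field_simps has_real_derivative_iff_has_vector_derivative[symmetric])
  then have "integral {0..L} (\<lambda>s. u + s / L * w) = L * (u + w / 2)"
    using L by (simp add: has_integral_integrable_integral field_simps power2_eq_square)
  then show "edge_inner K E f (edge_legendre K E 0) = L * (u + w / 2)"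
    by (simp add: edge_inner_def leg pt[symmetric] edge_length_eq[OF T, folded E_def L_def] legendre_0
        f[of "_ / L", folded pt])
  \<comment> \<open>\<open>?F\<close> is an antiderivative of the product of the affine function with \<open>2 s / L - 1\<close>.\<close>
  let ?F = "\<lambda>s. - u * s + (2 * u - w) / (2 * L) * s\<^sup>2 + 2 * w / (3 * L\<^sup>2) * s ^ 3"
  have "((\<lambda>s. (u + s / L * w) * (2 * (s / L) - 1)) has_integral ?F L - ?F 0) {0..L}"
    using L by (intro fundamental_theorem_of_calculus)
      (auto intro!: derivative_eq_intros simp: field_simps power2_eq_square
        has_real_derivative_iff_has_vector_derivative[symmetric])
  then have "integral {0..L} (\<lambda>s. (u + s / L * w) * (2 * (s / L) - 1)) = L * w / 6"
    using L by (simp add: has_integral_integrable_integral field_simps power2_eq_square power3_eq_cube)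
  then show "edge_inner K E f (edge_legendre K E 1) = L * w / 6"
    unfolding edge_inner_def leg legendre_1 edge_length_eq[OF T, folded E_def L_def] f[of "_ / L", folded pt]
    by (simp add: algebra_simps)
qed

lemma edge_norm_legendre:
  assumes T: "pos_triangle K p q r"
  defines "E \<equiv> convex hull {p, q}" and "L \<equiv> norm (q - p)"
  shows "(edge_norm K E (edge_legendre K E 0))\<^sup>2 = L"
    and "(edge_norm K E (edge_legendre K E 1))\<^sup>2 = L / 3"
proof -
  have L: "L > 0"
    using pos_triangle_independent(2)[OF T] by (simp add: L_def)
  have arg: "2 * (edge_tangent K E \<bullet> (p + \<tau> *\<^sub>R (q - p) - edge_start K E)) / edge_length K E - 1 = - 1 + \<tau> * 2" for \<tau>
    unfolding E_def edge_tangent_eq[OF T] edge_start_end_eq[OF T] edge_length_eq[OF T] L_def[symmetric]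
    using L by (simp add: dot_square_norm L_def[symmetric] power2_eq_square)
  have 0: "edge_legendre K E 0 (p + \<tau> *\<^sub>R (q - p)) = 1 + \<tau> * 0" for \<tau>
    by (simp add: edge_legendre_def legendre_0)
  have 1: "edge_legendre K E 1 (p + \<tau> *\<^sub>R (q - p)) = - 1 + \<tau> * 2" for \<tau>
    unfolding edge_legendre_def legendre_1 arg by simp
  show "(edge_norm K E (edge_legendre K E 0))\<^sup>2 = L"
    unfolding edge_norm_def E_def edge_inner_legendre(1)[OF T 0[unfolded E_def]] L_def[symmetric]
    using L by simp
  show "(edge_norm K E (edge_legendre K E 1))\<^sup>2 = L / 3"
    unfolding edge_norm_def E_def edge_inner_legendre(2)[OF T 1[unfolded E_def]] L_def[symmetric]
    using L by simp
qed

text \<open>The moments of an affine function depend on its values at the end points only. In the two moments of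
  the second trace, the contributions of the quadratic part found in \<open>tangential_on_line\<close> cancel (order 0)
  or add half of the increment of the divergence to itself (order 1).\<close>

lemma edge_moments:
  fixes b p :: "real^2" and \<theta> :: coeffs
  assumes T: "pos_triangle K p q r"
  defines "E \<equiv> convex hull {p, q}" and "M \<equiv> tensor_field b \<theta>" and "d \<equiv> field_div b \<theta>" and "e \<equiv> q - p"
  shows "edge_inner K E (tr_n K E M) (edge_legendre K E 0) / (edge_norm K E (edge_legendre K E 0))\<^sup>2 =
      (normal_entry M e p + normal_entry M e q) / 2"
    and "edge_inner K E (tr_n K E M) (edge_legendre K E 1) / (edge_norm K E (edge_legendre K E 1))\<^sup>2 =
      (normal_entry M e q - normal_entry M e p) / 2"
    and "edge_inner K E (tr_t K E M) (edge_legendre K E 0) =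
      cw e \<bullet> (d p + d q) / 2 + tangential_entry M e q - tangential_entry M e p"
    and "edge_inner K E (tr_t K E M) (edge_legendre K E 1) = cw e \<bullet> (d q - d p) / 4"
proof -
  have L: "norm e > 0"
    using pos_triangle_independent(2)[OF T] by (simp add: e_def)
  have q: "p + e = q" by (simp add: e_def)
  have n: "tr_n K E M (p + \<tau> *\<^sub>R (q - p)) = normal_entry M e p + \<tau> * (normal_entry M e q - normal_entry M e p)" for \<tau>
    unfolding E_def tr_n_eq[OF T] e_def[symmetric] normal_entry_def M_def normal_on_line[of e b \<theta> p \<tau>] q
    by (simp add: add_divide_distrib diff_divide_distrib algebra_simps)
  let ?u = "(cw e \<bullet> d p + tangential_entry M e q - tangential_entry M e p - cw e \<bullet> (d q - d p) / 4) / norm e"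
  let ?w = "(3 / 2 * (cw e \<bullet> (d q - d p))) / norm e"
  have t: "tr_t K E M (p + \<tau> *\<^sub>R (q - p)) = ?u + \<tau> * ?w" for \<tau>
    using tr_t_on_edge[OF T, of b \<theta> \<tau>] unfolding E_def M_def d_def e_def
    by (simp only: add_divide_distrib times_divide_eq_right)
  note I = edge_inner_legendre[OF T, folded E_def e_def] and N = edge_norm_legendre[OF T, folded E_def e_def]
  show "edge_inner K E (tr_n K E M) (edge_legendre K E 0) / (edge_norm K E (edge_legendre K E 0))\<^sup>2 =
      (normal_entry M e p + normal_entry M e q) / 2"
    unfolding N I(1)[OF n[unfolded e_def[symmetric]]] using L by (simp add: field_simps)
  show "edge_inner K E (tr_n K E M) (edge_legendre K E 1) / (edge_norm K E (edge_legendre K E 1))\<^sup>2 =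
      (normal_entry M e q - normal_entry M e p) / 2"
    unfolding N I(2)[OF n[unfolded e_def[symmetric]]] using L by (simp add: field_simps)
  show "edge_inner K E (tr_t K E M) (edge_legendre K E 0) =
      cw e \<bullet> (d p + d q) / 2 + tangential_entry M e q - tangential_entry M e p"
    unfolding I(1)[OF t[unfolded e_def[symmetric]]] using L
    by (simp add: inner_add_right inner_diff_right field_simps)
  show "edge_inner K E (tr_t K E M) (edge_legendre K E 1) = cw e \<bullet> (d q - d p) / 4"
    unfolding I(2)[OF t[unfolded e_def[symmetric]]] using L by (simp add: field_simps)
qed

lemma jump_eq:
  assumes "pos_triangle K p q r"
  shows "jump K M q = tangential_entry M (q - p) q - tangential_entry M (r - q) q"
  unfolding jump_def edges_at_vertex_eq[OF assms] tMn_eq[OF assms] tMn_eq[OF pos_triangle_rotate[OF assms]] ..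

section \<open>Unisolvence\<close>

text \<open>Expansions of \<open>w\<close> in the bases \<open>e, e'\<close> and \<open>cw e, cw e'\<close>, up to the determinant.\<close>

lemma cw_basis: "(e \<bullet> cw e') *\<^sub>R w = (w \<bullet> cw e') *\<^sub>R e - (w \<bullet> cw e) *\<^sub>R e'"
  by (simp add: vec_eq_2 inner_2 algebra_simps)

lemma cw_basis': "(e \<bullet> cw e') *\<^sub>R w = (w \<bullet> e) *\<^sub>R cw e' - (w \<bullet> e') *\<^sub>R cw e"
  by (simp add: vec_eq_2 inner_2 algebra_simps)

lemma eq_0_if_normal_components_0:
  assumes "e \<bullet> cw e' \<noteq> 0" "w \<bullet> cw e = 0" "w \<bullet> cw e' = 0"
  shows "w = 0"
  using cw_basis[of e e' w] assms by simp

text \<open>Expanding \<open>e\<close> and \<open>e'\<close> in the basis of the two normals shows that the two tangential-normal entries are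
  \<open>m / D\<close> and \<open>- m / D\<close>, where \<open>m\<close> is the mixed normal-normal entry and \<open>D\<close> the determinant of
  \<open>e, e'\<close>. If they agree, then \<open>m = 0\<close>.\<close>

lemma symmetric_eq_0_if_traces_0:
  fixes M :: "real^2^2"
  assumes sym: "M $ 1 $ 2 = M $ 2 $ 1" and D: "e \<bullet> cw e' \<noteq> 0"
    and n: "cw e \<bullet> (M *v cw e) = 0" "cw e' \<bullet> (M *v cw e') = 0"
    and t: "(e \<bullet> (M *v cw e)) / (e \<bullet> e) = (e' \<bullet> (M *v cw e')) / (e' \<bullet> e')"
  shows "M = 0"
proof -
  let ?D = "e \<bullet> cw e'" and ?m = "cw e' \<bullet> (M *v cw e)"
  have m: "cw e \<bullet> (M *v cw e') = ?m"
    using sym by (simp add: matrix_vector_mult_2 inner_2 algebra_simps)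
  have ne: "e \<bullet> e \<noteq> 0" "e' \<bullet> e' \<noteq> 0" using D by (auto simp: inner_2)
  have "?D * (e \<bullet> (M *v cw e)) = (e \<bullet> e) * ?m"
    using arg_cong[OF cw_basis'[of e e' e], of "\<lambda>w. w \<bullet> (M *v cw e)"] n
    by (simp add: inner_diff_left)
  moreover have "?D * (e' \<bullet> (M *v cw e')) = - (e' \<bullet> e') * ?m"
    using arg_cong[OF cw_basis'[of e e' e'], of "\<lambda>w. w \<bullet> (M *v cw e')"] n m
    by (simp add: inner_diff_left)
  moreover have "(e \<bullet> (M *v cw e)) * (e' \<bullet> e') = (e' \<bullet> (M *v cw e')) * (e \<bullet> e)"
    using t ne by (simp add: frac_eq_eq)
  then have "(?D * (e \<bullet> (M *v cw e))) * (e' \<bullet> e') = (?D * (e' \<bullet> (M *v cw e'))) * (e \<bullet> e)"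
    by (metis mult.assoc)
  ultimately have "(e \<bullet> e) * ?m * (e' \<bullet> e') = (- (e' \<bullet> e') * ?m) * (e \<bullet> e)"
    by simp
  then have m0: "?m = 0" using ne by (simp add: algebra_simps)
  have z: "M *v w = 0" if w: "cw e \<bullet> (M *v w) = 0" "cw e' \<bullet> (M *v w) = 0" for w
    using eq_0_if_normal_components_0[OF D, of "M *v w"] w by (simp add: inner_commute)
  have z1: "M *v cw e = 0" "M *v cw e' = 0"
    using z n m m0 by auto
  have "?D *\<^sub>R (M *v w) = 0" for w
  proof -
    have "?D *\<^sub>R (M *v w) = M *v (?D *\<^sub>R w)" by (simp add: matrix_vector_mult_scaleR)
    also have "\<dots> = 0"
      unfolding cw_basis'[of e e' w] by (simp add: matrix_vector_mult_diff_distrib matrix_vector_mult_scaleR z1)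
    finally show ?thesis .
  qed
  then have "M *v w = 0" for w using D by simp
  then show "M = 0" by (simp add: matrix_eq)
qed

text \<open>With the vertex \<open>p\<close> as base point, the values at \<open>p\<close> give \<open>S\<^sub>0 = 0\<close> and make the constant part of the
  divergence vanish. Let \<open>u\<close>, \<open>v\<close> be the other two vertices relative to \<open>p\<close>. The divergence at them
  shows \<open>A u = \<sigma> u\<close> and \<open>A v = \<tau> v\<close> with \<open>\<sigma> = - (tr A / 4 + 2 (c \<bullet> u))\<close> and similarly for \<open>\<tau>\<close>; the
  trace of \<open>A\<close> is \<open>\<sigma> + \<tau>\<close>. The tensor at them gives the linear part \<open>- (\<sigma> + c \<bullet> u) u u\<^sup>T\<close> at \<open>u\<close>
  and the analogue at \<open>v\<close>. The divergence of this linear part is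
  \<open>- (\<sigma> + c \<bullet> u) u - (\<tau> + c \<bullet> v) v\<close> and vanishes, so \<open>\<sigma> = - (c \<bullet> u)\<close> and \<open>\<tau> = - (c \<bullet> v)\<close>. With
  the formulas for \<open>\<sigma>\<close> and \<open>\<tau>\<close> this yields \<open>\<sigma> = (\<sigma> + \<tau>) / 4 = \<tau>\<close>, hence \<open>\<sigma> = \<tau> = 0\<close>.\<close>

lemma eq_0_if_vertex_values_0:
  assumes D: "(q - p) \<bullet> cw (r - p) \<noteq> 0"
    and M: "\<And>x. x \<in> {p, q, r} \<Longrightarrow> tensor_field p \<theta> x = 0"
    and d: "\<And>x. x \<in> {p, q, r} \<Longrightarrow> field_div p \<theta> x = 0"
  shows "\<theta> = 0"
proof -
  obtain S0 S1 S2 A c where \<theta>: "\<theta> = (S0, S1, S2, A, c)" by (cases \<theta>)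
  define u v where "u = q - p" and "v = r - p"
  have D: "u \<bullet> cw v \<noteq> 0" using D by (simp add: u_def v_def)
  have "sym_of S0 = 0"
    using M[of p] by (simp add: \<theta> tensor_field_def Let_def vec_eq_2)
  then have S0: "S0 = 0"
    by (simp add: vec_eq_2 vec_eq_iff[of S0] forall_3)
  have divS: "S1 $ 1 + S2 $ 2 = 0" "S1 $ 2 + S2 $ 3 = 0"
    using d[of p] by (simp_all add: \<theta> field_div_def Let_def vec_eq_2)
  have divS': "vector [S1 $ 1 + S2 $ 2, S1 $ 2 + S2 $ 3] = (0 :: real^2)"
    using divS by (simp add: vec_eq_2)
  \<comment> \<open>the eigenvalue, \<open>\<sigma>\<close> for \<open>u\<close> and \<open>\<tau>\<close> for \<open>v\<close>\<close>
  define ev where "ev w = - (trace A / 4 + 2 * (c \<bullet> w))" for w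
  have eigen: "A *v w = ev w *\<^sub>R w" if "w \<in> {u, v}" for w
  proof -
    have "p + w \<in> {p, q, r}" using that by (auto simp: u_def v_def)
    from d[OF this] have "2 *\<^sub>R (A *v w) + (trace A / 2 + 4 * (c \<bullet> w)) *\<^sub>R w = 0"
      by (simp add: \<theta> field_div_def Let_def divS')
    then have "2 *\<^sub>R (A *v w) = 2 *\<^sub>R (ev w *\<^sub>R w)"
      by (simp add: ev_def vec_eq_2 algebra_simps)
    then show ?thesis by (rule scaleR_left_imp_eq[rotated]) simp
  qed
  have "(u \<bullet> cw v) * trace A = (A *v u) \<bullet> cw v + u \<bullet> cw (A *v v)"
    by (simp add: trace_def sum_2 matrix_vector_mult_2 inner_2 algebra_simps)
  also have "\<dots> = (u \<bullet> cw v) * (ev u + ev v)"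
    unfolding eigen[of u, simplified] eigen[of v, simplified] by (simp add: inner_2 algebra_simps)
  finally have tr: "trace A = ev u + ev v"
    using D by simp
  define k where "k w = ev w + c \<bullet> w" for w
  have S: "w $ 1 *\<^sub>R S1 + w $ 2 *\<^sub>R S2 = - k w *\<^sub>R vector [w $ 1 * w $ 1, w $ 1 * w $ 2, w $ 2 * w $ 2]"
    if "w \<in> {u, v}" for w
  proof -
    have "p + w \<in> {p, q, r}" using that by (auto simp: u_def v_def)
    from M[OF this] have "w $ 1 *\<^sub>R sym_of S1 + w $ 2 *\<^sub>R sym_of S2 + sym_mat (outer w (k w *\<^sub>R w)) = 0"
      by (simp add: \<theta> S0 tensor_field_def Let_def eigen[OF that] k_def scaleR_add_left vec_eq_2)
    then show ?thesis
      by (simp add: vec_eq_2 vec_eq_iff[where 'b = 3] forall_3 algebra_simps)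
  qed
  have Su: "u $ 1 * S1 $ i + u $ 2 * S2 $ i = - k u * (vector [u $ 1 * u $ 1, u $ 1 * u $ 2, u $ 2 * u $ 2] :: real^3) $ i" for i
    using arg_cong[OF S[of u], of "\<lambda>x. x $ i"] by simp
  have Sv: "v $ 1 * S1 $ i + v $ 2 * S2 $ i = - k v * (vector [v $ 1 * v $ 1, v $ 1 * v $ 2, v $ 2 * v $ 2] :: real^3) $ i" for i
    using arg_cong[OF S[of v], of "\<lambda>x. x $ i"] by simp
  \<comment> \<open>By Cramer's rule for \<open>Su\<close> and \<open>Sv\<close>, the left-hand side is minus the determinant times the constant
    part of the divergence.\<close>
  have "(u \<bullet> cw v) *\<^sub>R (k u *\<^sub>R u + k v *\<^sub>R v) = 0"
    using Su[of 1] Su[of 2] Su[of 3] Sv[of 1] Sv[of 2] Sv[of 3] divS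
    by (simp add: vec_eq_2 inner_2) algebra
  then have ksum: "k u *\<^sub>R u + k v *\<^sub>R v = 0" using D by simp
  have "(k u *\<^sub>R u + k v *\<^sub>R v) \<bullet> cw v = k u * (u \<bullet> cw v)" "(k u *\<^sub>R u + k v *\<^sub>R v) \<bullet> cw u = - (k v * (u \<bullet> cw v))"
    by (simp_all add: inner_2 algebra_simps)
  then have k: "k u = 0" "k v = 0"
    using D unfolding ksum by auto
  have "S1 $ i = 0 \<and> S2 $ i = 0" for i
  proof -
    have "vector [S1 $ i, S2 $ i] \<bullet> u = 0" "vector [S1 $ i, S2 $ i] \<bullet> v = 0"
      using Su[of i] Sv[of i] k by (simp_all add: inner_2 algebra_simps)
    then have "vector [S1 $ i, S2 $ i] = (0 :: real^2)"
      using cw_basis'[of u v "vector [S1 $ i, S2 $ i]"] D by simp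
    then show ?thesis by (simp add: vec_eq_2)
  qed
  then have S12: "S1 = 0" "S2 = 0" by (simp_all add: vec_eq_iff)
  have "ev u = - (trace A / 4 + 2 * (c \<bullet> u))" "ev v = - (trace A / 4 + 2 * (c \<bullet> v))"
    by (simp_all only: ev_def)
  then have ev: "ev u = 0" "ev v = 0"
    using k tr unfolding k_def by linarith+
  have "c \<bullet> u = 0" "c \<bullet> v = 0"
    using k ev by (simp_all add: k_def)
  then have c: "c = 0"
    using cw_basis'[of u v c] D by simp
  have "(u \<bullet> cw v) *\<^sub>R (A *v w) = 0" for w
  proof -
    have "(u \<bullet> cw v) *\<^sub>R (A *v w) = A *v ((u \<bullet> cw v) *\<^sub>R w)" by (simp add: matrix_vector_mult_scaleR)
    also have "\<dots> = 0"
      unfolding cw_basis[of u v w] using eigen[of u] eigen[of v] ev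
      by (simp add: matrix_vector_mult_diff_distrib matrix_vector_mult_scaleR)
    finally show ?thesis .
  qed
  then have "A *v w = 0" for w using D by simp
  then have "A = 0" by (simp add: matrix_eq)
  then show ?thesis by (simp add: \<theta> S0 S12 c zero_prod_def)
qed

type_synonym dofs = "real \<times> real \<times> real \<times> real \<times> real"

text \<open>The two moments of the first trace, the two moments of the second trace, and the jump at the end point
  of the edge from \<open>p\<close> to \<open>q\<close>, for a tensor \<open>M\<close> with divergence \<open>d\<close>. Attributing to every edge the
  jump at its end point lists each vertex once.\<close>

definition edge_dofs :: "(real^2 \<Rightarrow> real^2^2) \<Rightarrow> (real^2 \<Rightarrow> real^2) \<Rightarrow> real^2 \<Rightarrow> real^2 \<Rightarrow> real^2 \<Rightarrow> dofs"
  where "edge_dofs M d p q r =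
    ((normal_entry M (q - p) p + normal_entry M (q - p) q) / 2,
     (normal_entry M (q - p) q - normal_entry M (q - p) p) / 2,
     cw (q - p) \<bullet> (d p + d q) / 2 + tangential_entry M (q - p) q - tangential_entry M (q - p) p,
     cw (q - p) \<bullet> (d q - d p) / 4,
     tangential_entry M (q - p) q - tangential_entry M (r - q) q)"

lemma linear_edge_dofs: "linear (\<lambda>\<theta>. edge_dofs (tensor_field b \<theta>) (field_div b \<theta>) p q r)"
proof (rule linearI)
  note M = linear_tensor_field[of b] and d = linear_field_div[of b]
  fix \<theta> \<theta>' and s :: real
  show "edge_dofs (tensor_field b (\<theta> + \<theta>')) (field_div b (\<theta> + \<theta>')) p q r =
      edge_dofs (tensor_field b \<theta>) (field_div b \<theta>) p q r + edge_dofs (tensor_field b \<theta>') (field_div b \<theta>') p q r"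
    by (simp add: edge_dofs_def normal_entry_def tangential_entry_def linear_add[OF M] linear_add[OF d]
        matrix_vector_mult_add_rdistrib inner_add_right inner_diff_right add_divide_distrib diff_divide_distrib)
  show "edge_dofs (tensor_field b (s *\<^sub>R \<theta>)) (field_div b (s *\<^sub>R \<theta>)) p q r =
      s *\<^sub>R edge_dofs (tensor_field b \<theta>) (field_div b \<theta>) p q r"
    by (simp add: edge_dofs_def normal_entry_def tangential_entry_def linear_scale[OF M] linear_scale[OF d]
        scaleR_matrix_vector_assoc[symmetric] inner_add_right inner_diff_right add_divide_distrib
        diff_divide_distrib right_diff_distrib distrib_left)
qed

definition all_dofs :: "real^2 \<Rightarrow> real^2 \<Rightarrow> real^2 \<Rightarrow> coeffs \<Rightarrow> dofs \<times> dofs \<times> dofs"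
  where "all_dofs p q r \<theta> = (let M = tensor_field p \<theta>; d = field_div p \<theta> in
    (edge_dofs M d p q r, edge_dofs M d q r p, edge_dofs M d r p q))"

lemma linear_all_dofs: "linear (all_dofs p q r)"
  unfolding all_dofs_def Let_def
  using linear_edge_dofs[of p p q r] linear_edge_dofs[of p q r p] linear_edge_dofs[of p r p q]
  by (simp add: linear_iff)

lemma tensor_field_symmetric: "tensor_field b \<theta> x $ 1 $ 2 = tensor_field b \<theta> x $ 2 $ 1"
  by (cases \<theta>) (simp add: tensor_field_def Let_def)

text \<open>The two moments of an affine function determine its end-point values. Hence the first trace and the jumps
  annihilate the tensor at the vertices; after that the moments of the second trace see only the divergence.\<close>

lemma all_dofs_0_imp:
  assumes T: "(q - p) \<bullet> cw (r - p) \<noteq> 0" and 0: "all_dofs p q r \<theta> = 0"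
  shows "\<theta> = 0"
proof -
  let ?M = "tensor_field p \<theta>" and ?d = "field_div p \<theta>"
  have z: "edge_dofs ?M ?d p q r = 0" "edge_dofs ?M ?d q r p = 0" "edge_dofs ?M ?d r p q = 0"
    using 0 by (simp_all add: all_dofs_def zero_prod_def Let_def)
  have rot: "(r - q) \<bullet> cw (p - q) = (q - p) \<bullet> cw (r - p)" "(p - r) \<bullet> cw (q - r) = (q - p) \<bullet> cw (r - p)"
    by (simp_all add: inner_2 algebra_simps)
  have normal0: "normal_entry ?M (y - x) x = 0 \<and> normal_entry ?M (y - x) y = 0" if "edge_dofs ?M ?d x y w = 0" for x y w
    using that by (auto simp: edge_dofs_def zero_prod_def)
  have M0: "?M y = 0"
    if D: "(y - x) \<bullet> cw (w - x) \<noteq> 0" and e: "edge_dofs ?M ?d x y w = 0" "edge_dofs ?M ?d y w x = 0" for x y w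
  proof -
    have ne: "(y - x) \<bullet> cw (w - y) \<noteq> 0"
      using D by (simp add: inner_2 algebra_simps)
    then have nz: "(y - x) \<bullet> (y - x) \<noteq> 0" "(w - y) \<bullet> (w - y) \<noteq> 0"
      by (auto simp: inner_2)
    have "tangential_entry ?M (y - x) y = tangential_entry ?M (w - y) y"
      using e by (simp add: edge_dofs_def zero_prod_def)
    with normal0[OF e(1)] normal0[OF e(2)] show ?thesis
      using symmetric_eq_0_if_traces_0[OF tensor_field_symmetric ne] nz by (simp add: normal_entry_def tangential_entry_def)
  qed
  have Mq: "?M q = 0" and Mr: "?M r = 0" and Mp: "?M p = 0"
    using M0[of q p r] M0[of r q p] M0[of p r q] T z unfolding rot by blast+
  then have M: "?M x = 0" if "x \<in> {p, q, r}" for x using that by blast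
  have d0: "cw (y - x) \<bullet> ?d x = 0 \<and> cw (y - x) \<bullet> ?d y = 0"
    if "edge_dofs ?M ?d x y w = 0" "x \<in> {p, q, r}" "y \<in> {p, q, r}" for x y w
    using that(1) M[OF that(2)] M[OF that(3)]
    by (auto simp: edge_dofs_def zero_prod_def tangential_entry_def inner_add_right inner_diff_right)
  have d1: "?d y = 0"
    if D: "(y - x) \<bullet> cw (w - x) \<noteq> 0" and e: "edge_dofs ?M ?d x y w = 0" "edge_dofs ?M ?d y w x = 0"
      and v: "x \<in> {p, q, r}" "y \<in> {p, q, r}" "w \<in> {p, q, r}" for x y w
  proof (rule eq_0_if_normal_components_0)
    show "(y - x) \<bullet> cw (w - y) \<noteq> 0"
      using D by (simp add: inner_2 algebra_simps)
    show "?d y \<bullet> cw (y - x) = 0" "?d y \<bullet> cw (w - y) = 0"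
      using d0[OF e(1)] d0[OF e(2)] v by (auto simp: inner_commute)
  qed
  have "?d q = 0" "?d r = 0" "?d p = 0"
    using d1[of q p r] d1[of r q p] d1[of p r q] T z unfolding rot by blast+
  then have "?d x = 0" if "x \<in> {p, q, r}" for x using that by blast
  with M show ?thesis
    using eq_0_if_vertex_values_0[OF T] by blast
qed

lemma bij_all_dofs:
  assumes "(q - p) \<bullet> cw (r - p) \<noteq> 0"
  shows "bij (all_dofs p q r)"
proof -
  have "inj (all_dofs p q r)"
    unfolding linear_injective_0[OF linear_all_dofs] using all_dofs_0_imp[OF assms] by blast
  moreover from this have "surj (all_dofs p q r)"
    by (rule linear_injective_imp_surjective[OF linear_all_dofs]) simp
  ultimately show ?thesis by (rule bijI)
qed

text \<open>Every tensor of the space is \<open>tensor_field p \<theta>\<close> for some coefficients \<open>\<theta>\<close>, and bijectivity of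
  \<open>all_dofs p q r\<close> provides the coefficients for the prescribed data. Injectivity also shows that
  different tensors cannot share their data, whichever coefficients represent them.\<close>

theorem theorem5:
  fixes K :: "(real^2) set"
    and a b :: "(real^2) set \<Rightarrow> nat \<Rightarrow> real"
    and c :: "real^2 \<Rightarrow> real"
  assumes "2 simplex K"
  shows "\<exists>!M. M \<in> X_triangle \<and>
    (\<forall>E k. E edge_of K \<and> k \<in> {0, 1} \<longrightarrow>
      edge_inner K E (tr_n K E M) (edge_legendre K E k) / (edge_norm K E (edge_legendre K E k))\<^sup>2
        = a E k) \<and>
    (\<forall>E k. E edge_of K \<and> k \<in> {0, 1} \<longrightarrow>
      edge_inner K E (tr_t K E M) (edge_legendre K E k) = b E k) \<and>
    (\<forall>z. z extreme_point_of K \<longrightarrow> jump K M z = c z)"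
proof -
  obtain p q r where T: "pos_triangle K p q r"
    using simplex_imp_pos_triangle[OF assms] .
  note T' = pos_triangle_rotate[OF T] and T'' = pos_triangle_rotate[OF pos_triangle_rotate[OF T]]
  let ?prescribed = "\<lambda>M. (\<forall>E k. E edge_of K \<and> k \<in> {0, 1} \<longrightarrow>
      edge_inner K E (tr_n K E M) (edge_legendre K E k) / (edge_norm K E (edge_legendre K E k))\<^sup>2
        = a E k) \<and>
    (\<forall>E k. E edge_of K \<and> k \<in> {0, 1} \<longrightarrow>
      edge_inner K E (tr_t K E M) (edge_legendre K E k) = b E k) \<and>
    (\<forall>z. z extreme_point_of K \<longrightarrow> jump K M z = c z)"
  define data where "data x y =
      (a (convex hull {x, y}) 0, a (convex hull {x, y}) 1, b (convex hull {x, y}) 0, b (convex hull {x, y}) 1, c y)"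
    for x y :: "real^2"
  have all: "(\<forall>E k. E edge_of K \<and> k \<in> {0, 1} \<longrightarrow> Q E k) \<longleftrightarrow>
      (Q (convex hull {p, q}) 0 \<and> Q (convex hull {p, q}) 1) \<and>
      (Q (convex hull {q, r}) 0 \<and> Q (convex hull {q, r}) 1) \<and>
      (Q (convex hull {r, p}) 0 \<and> Q (convex hull {r, p}) 1)" for Q :: "(real^2) set \<Rightarrow> nat \<Rightarrow> bool"
    unfolding edge_of_pos_triangle[OF T] by blast
  have vert: "(\<forall>z. z extreme_point_of K \<longrightarrow> Q z) \<longleftrightarrow> Q p \<and> Q q \<and> Q r" for Q
    unfolding extreme_point_of_pos_triangle[OF T] by blast
  have iff: "?prescribed (tensor_field p \<theta>) \<longleftrightarrow> all_dofs p q r \<theta> = (data p q, data q r, data r p)" for \<theta>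
    unfolding all vert edge_moments[OF T] edge_moments[OF T'] edge_moments[OF T'']
      jump_eq[OF T] jump_eq[OF T'] jump_eq[OF T''] all_dofs_def Let_def edge_dofs_def data_def prod.inject
    by (intro iffI; elim conjE; intro conjI; assumption)
  have "\<exists>!\<theta>. all_dofs p q r \<theta> = (data p q, data q r, data r p)"
  proof -
    have "bij (all_dofs p q r)"
      using T by (intro bij_all_dofs) (simp add: pos_triangle_def)
    then show ?thesis unfolding bij_iff by (rule spec)
  qed
  then obtain \<theta> where \<theta>: "all_dofs p q r \<theta> = (data p q, data q r, data r p)"
    and unique: "\<And>\<theta>'. all_dofs p q r \<theta>' = (data p q, data q r, data r p) \<Longrightarrow> \<theta>' = \<theta>"
    by blast
  show ?thesis
  proof (rule ex1I)
    show "tensor_field p \<theta> \<in> X_triangle \<and> ?prescribed (tensor_field p \<theta>)"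
      unfolding X_triangle_eq[of p] using \<theta> iff by blast
    fix M assume M: "M \<in> X_triangle \<and> ?prescribed M"
    then obtain \<theta>' where "M = tensor_field p \<theta>'"
      unfolding X_triangle_eq[of p] by blast
    then show "M = tensor_field p \<theta>"
      using M iff unique by blast
  qed
qed

end
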